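(* An oriented graph $D$ is $3$-anti-traceable if and only if $D$ is isomorphic to a composition $T[I_1, I_2,\dots, I_t]$ for some positive integer $t$, where $T$ is a transitive tournament on $t$ vertices and each $I_i$ ($i\in[t]$) is an independent set (digraph with no arcs) on at most two vertices.
   Context: An oriented graph is a digraph obtained by orienting the edges of a simple undirected graph (no loops, no 2-cycles). An oriented path $x_1x_2\dots x_p$ is anti-directed if every two consecutive arcs have opposite orientations, i.e. for every $1\le i\le p-2$ either $x_i\to x_{i+1}\leftarrow x_{i+2}$ or $x_i\leftarrow x_{i+1}\to x_{i+2}$. A digraph is anti-traceable if it has an anti-directed path containing all its vertices (a hamiltonian anti-directed path). A digraph $D$ is $k$-anti-traceable if it has at least $k$ vertices and every induced subdigraph of $D$ on $k$ vertices is anti-traceable. For a digraph $T$ with vertices $v_1,\dots,v_t$ and digraphs $H_1,\dots,H_t$, the composition $T[H_1,\dots,H_t]$ has vertex set $\bigcup_i V(H_i)$ (disjoint union) and arc set $\bigcup_i A(H_i)\cup\{x_ix_j: v_iv_j\in A(T), x_i\in V(H_i), x_j\in V(H_j), i\neq j\}$.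
   Formalization: The formal theorem assumes that D has at least 3 vertices: a 3-anti-traceable digraph has at least 3 vertices by definition, while every oriented graph on 1 or 2 vertices is such a composition, so the "if" direction fails for those. *)

theory Defs
  imports "Graph_Theory.Graph_Theory"
begin

locale oriented_graph = digraph +
  assumes no_2_cycle: "u \<rightarrow> v \<Longrightarrow> \<not> v \<rightarrow> u"

locale tournament = oriented_graph +
  assumes semicomplete: "\<lbrakk>u \<in> verts G; v \<in> verts G; u \<noteq> v\<rbrakk> \<Longrightarrow> u \<rightarrow> v \<or> v \<rightarrow> u"

locale transitive_tournament = tournament +
  assumes transitive: "trans (arcs_ends G)"

definition oriented_path :: "('a, 'b) pre_digraph \<Rightarrow> 'a list \<Rightarrow> bool" where
  "oriented_path G xs \<longleftrightarrow> xs \<noteq> [] \<and> distinct xs \<and> set xs \<subseteq> verts G \<and>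
     (\<forall>i. i + 1 < length xs \<longrightarrow> xs ! i \<rightarrow>\<^bsub>G\<^esub> xs ! (i + 1) \<or> xs ! (i + 1) \<rightarrow>\<^bsub>G\<^esub> xs ! i)"

text \<open>A path is given by its vertex sequence, which determines its arcs only if \<open>G\<close> has no
  2-cycles; the notion is meant for oriented graphs.\<close>

definition anti_directed_path :: "('a, 'b) pre_digraph \<Rightarrow> 'a list \<Rightarrow> bool" where
  "anti_directed_path G xs \<longleftrightarrow> oriented_path G xs \<and>
     (\<forall>i. i + 2 < length xs \<longrightarrow>
        (xs ! i \<rightarrow>\<^bsub>G\<^esub> xs ! (i + 1) \<and> xs ! (i + 2) \<rightarrow>\<^bsub>G\<^esub> xs ! (i + 1)) \<or>
        (xs ! (i + 1) \<rightarrow>\<^bsub>G\<^esub> xs ! i \<and> xs ! (i + 1) \<rightarrow>\<^bsub>G\<^esub> xs ! (i + 2)))"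

definition anti_traceable :: "('a, 'b) pre_digraph \<Rightarrow> bool" where
  "anti_traceable G \<longleftrightarrow> (\<exists>xs. anti_directed_path G xs \<and> set xs = verts G)"

definition k_anti_traceable :: "nat \<Rightarrow> ('a, 'b) pre_digraph \<Rightarrow> bool" where
  "k_anti_traceable k G \<longleftrightarrow> k \<le> card (verts G) \<and>
     (\<forall>S. S \<subseteq> verts G \<and> card S = k \<longrightarrow> anti_traceable (G \<restriction> S))"

text \<open>The digraph substituted for the vertex \<open>v\<close> of \<open>T\<close> is \<open>H v\<close>; tagging its vertices with
  \<open>v\<close> makes the union of the vertex sets disjoint.\<close>

definition composition ::
    "'a pair_pre_digraph \<Rightarrow> ('a \<Rightarrow> 'b pair_pre_digraph) \<Rightarrow> ('a \<times> 'b) pair_pre_digraph" where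
  "composition T H = \<lparr>
     pverts = (SIGMA v : pverts T. pverts (H v)),
     parcs = {((v, x), (v, y)) | v x y. v \<in> pverts T \<and> (x, y) \<in> parcs (H v)} \<union>
             {((v, x), (w, y)) | v w x y.
                (v, w) \<in> parcs T \<and> x \<in> pverts (H v) \<and> y \<in> pverts (H w) \<and> v \<noteq> w} \<rparr>"

text \<open>The null digraph is excluded, following the convention that digraphs have a vertex.\<close>

definition independent_digraph :: "'a pair_pre_digraph \<Rightarrow> bool" where
  "independent_digraph H \<longleftrightarrow> pair_digraph H \<and> pverts H \<noteq> {} \<and> parcs H = {}"

end

theory Submission
  imports Defs
begin

text \<open>On three vertices, an anti-directed hamiltonian path is a middle vertex that dominates, or is
  dominated by, both others. Requiring this for every triple forces domination to be transitive
  and non-adjacency to relate each vertex to at most one other, which then has the same in- and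
  out-neighbours. So domination is a strict weak order whose classes have at most two elements, and
  comparing in-degrees recovers it: the classes of equal in-degree are the independent sets.\<close>

section \<open>Anti-directed hamiltonian paths on three vertices\<close>

text \<open>The middle vertex is the first argument; the condition is symmetric in the two ends, so
  a path and its reversal need no separate cases.\<close>

definition anti_centre :: "('a, 'b) pre_digraph \<Rightarrow> 'a \<Rightarrow> 'a \<Rightarrow> 'a \<Rightarrow> bool" where
  "anti_centre G v u w \<longleftrightarrow>
     (u \<rightarrow>\<^bsub>G\<^esub> v \<and> w \<rightarrow>\<^bsub>G\<^esub> v) \<or> (v \<rightarrow>\<^bsub>G\<^esub> u \<and> v \<rightarrow>\<^bsub>G\<^esub> w)"

lemma arcs_ends_induce_subgraph: "arcs_ends (G \<restriction> S) = arcs_ends G \<inter> S \<times> S"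
  by (auto simp: arcs_ends_conv)

lemma anti_centre_induce_subgraph:
  assumes "{u, v, w} \<subseteq> S"
  shows "anti_centre (G \<restriction> S) v u w \<longleftrightarrow> anti_centre G v u w"
  using assms by (auto simp: anti_centre_def arcs_ends_induce_subgraph)

lemma anti_directed_path_three:
  "anti_directed_path G [u, v, w] \<longleftrightarrow> distinct [u, v, w] \<and> {u, v, w} \<subseteq> verts G \<and> anti_centre G v u w"
proof
  assume *: "anti_directed_path G [u, v, w]"
  then have "distinct [u, v, w]" "{u, v, w} \<subseteq> verts G"
    by (simp_all add: anti_directed_path_def oriented_path_def)
  moreover have "anti_centre G v u w"
    using * by (auto simp: anti_directed_path_def anti_centre_def dest!: spec[of _ 0])
  ultimately show "distinct [u, v, w] \<and> {u, v, w} \<subseteq> verts G \<and> anti_centre G v u w"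
    by blast
next
  assume "distinct [u, v, w] \<and> {u, v, w} \<subseteq> verts G \<and> anti_centre G v u w"
  then show "anti_directed_path G [u, v, w]"
    by (auto simp: anti_directed_path_def oriented_path_def anti_centre_def less_Suc_eq
        numeral_2_eq_2)
qed

text \<open>A path through all three vertices is a list of length three, and up to reversal only the
  choice of its middle vertex matters.\<close>

lemma anti_traceable_three_verts:
  assumes "verts G = {u, v, w}" and "distinct [u, v, w]"
  shows "anti_traceable G \<longleftrightarrow> anti_centre G u v w \<or> anti_centre G v u w \<or> anti_centre G w u v"
proof
  assume "anti_traceable G"
  then obtain xs where xs: "anti_directed_path G xs" "set xs = verts G"
    by (auto simp: anti_traceable_def)
  then have "distinct xs"
    by (simp add: anti_directed_path_def oriented_path_def)
  with xs(2) have "length xs = 3"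
    using assms by (simp flip: distinct_card)
  then obtain a b c where abc: "xs = [a, b, c]"
    by (auto simp: length_Suc_conv numeral_3_eq_3)
  with xs(1) have "distinct [a, b, c]" "anti_centre G b a c"
    by (simp_all add: anti_directed_path_three)
  moreover have "{a, b, c} = {u, v, w}"
    using xs(2) abc assms(1) by simp
  ultimately show "anti_centre G u v w \<or> anti_centre G v u w \<or> anti_centre G w u v"
    unfolding anti_centre_def by (simp add: set_eq_iff) metis
next
  assume "anti_centre G u v w \<or> anti_centre G v u w \<or> anti_centre G w u v"
  then have "anti_directed_path G [v, u, w] \<or> anti_directed_path G [u, v, w] \<or>
      anti_directed_path G [u, w, v]"
    using assms by (auto simp: anti_directed_path_three)
  then show "anti_traceable G"
    unfolding anti_traceable_def assms(1) by (elim disjE) (rule exI, erule conjI, auto)+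
qed

text \<open>This removes paths and induced subdigraphs: later arguments look only at arcs of
  \<open>G\<close> among three distinct vertices.\<close>

lemma three_anti_traceable_iff:
  "k_anti_traceable 3 G \<longleftrightarrow> 3 \<le> card (verts G) \<and>
     (\<forall>u \<in> verts G. \<forall>v \<in> verts G. \<forall>w \<in> verts G. distinct [u, v, w] \<longrightarrow>
        anti_centre G u v w \<or> anti_centre G v u w \<or> anti_centre G w u v)"
proof -
  have induced: "anti_traceable (G \<restriction> {u, v, w}) \<longleftrightarrow>
      anti_centre G u v w \<or> anti_centre G v u w \<or> anti_centre G w u v"
    if "distinct [u, v, w]" for u v w
    using anti_traceable_three_verts[OF induce_subgraph_verts that]
    by (simp add: anti_centre_induce_subgraph)
  have "(\<forall>S. S \<subseteq> verts G \<and> card S = 3 \<longrightarrow> anti_traceable (G \<restriction> S)) \<longleftrightarrow>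
      (\<forall>u \<in> verts G. \<forall>v \<in> verts G. \<forall>w \<in> verts G. distinct [u, v, w] \<longrightarrow>
        anti_traceable (G \<restriction> {u, v, w}))"
    unfolding card_3_iff by (auto, metis empty_subsetI insert_subset)
  then show ?thesis
    by (simp add: k_anti_traceable_def induced)
qed

lemma three_anti_traceableD:
  assumes "k_anti_traceable 3 G"
    and "u \<in> verts G" "v \<in> verts G" "w \<in> verts G" "u \<noteq> v" "u \<noteq> w" "v \<noteq> w"
  shows "anti_centre G u v w \<or> anti_centre G v u w \<or> anti_centre G w u v"
  using assms(1) unfolding three_anti_traceable_iff using assms(2-) by auto

section \<open>Isomorphisms as vertex maps\<close>

text \<open>Without parallel arcs an arc is determined by its ends, so the vertex map alone
  determines the arc map.\<close>

lemma (in nomulti_digraph) digraph_iso_with_proj_iff: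
  "digraph_iso G (with_proj H) \<longleftrightarrow>
     (\<exists>f. inj_on f (verts G) \<and> pverts H = f ` verts G \<and> parcs H = map_prod f f ` arcs_ends G)"
proof
  assume "digraph_iso G (with_proj H)"
  then obtain h where h: "digraph_isomorphism h" "with_proj H = app_iso h G"
    by (auto simp: digraph_iso_def)
  have "pverts H = iso_verts h ` verts G"
    using h(2) by (metis with_proj_simps(1) verts_app_iso)
  moreover have "parcs H = map_prod (iso_verts h) (iso_verts h) ` arcs_ends G"
    using arcs_ends_app_iso_eq[OF h(1)] by (simp flip: h(2) add: map_prod_def)
  ultimately show "\<exists>f. inj_on f (verts G) \<and> pverts H = f ` verts G \<and>
      parcs H = map_prod f f ` arcs_ends G"
    using digraph_isomorphism_inj_on_verts[OF h(1)] by blast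
next
  assume "\<exists>f. inj_on f (verts G) \<and> pverts H = f ` verts G \<and> parcs H = map_prod f f ` arcs_ends G"
  then obtain f where f: "inj_on f (verts G)" "pverts H = f ` verts G"
      "parcs H = map_prod f f ` arcs_ends G"
    by blast
  define h where "h = \<lparr>iso_verts = f, iso_arcs = \<lambda>e. (f (tail G e), f (head G e)),
    iso_head = snd, iso_tail = fst\<rparr>"
  have "inj_on (\<lambda>e. (f (tail G e), f (head G e))) (arcs G)"
    by (intro inj_onI no_multi_arcs) (auto simp: arc_to_ends_def dest: inj_onD[OF f(1)])
  then have "digraph_isomorphism h"
    using f(1) wf_digraph_axioms by (simp add: digraph_isomorphism_def h_def)
  moreover have "with_proj H = app_iso h G"
    by (simp add: with_proj_def app_iso_def h_def f(2,3) arcs_ends_conv image_image)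
  ultimately show "digraph_iso G (with_proj H)"
    by (auto simp: digraph_iso_def)
qed

section \<open>The order structure of 3-anti-traceable oriented graphs\<close>

context oriented_graph
begin

lemma not_dominates_self: "\<not> u \<rightarrow> u"
  using no_2_cycle by blast

text \<open>In a directed path of length two the middle vertex cannot be the centre, and either end
  as centre forces the shortcut arc.\<close>

lemma three_anti_traceable_imp_trans:
  assumes "k_anti_traceable 3 G"
  shows "trans (arcs_ends G)"
proof (rule transI)
  fix u v w
  assume uv: "u \<rightarrow> v" and vw: "v \<rightarrow> w"
  have "u \<noteq> w" "u \<noteq> v" "v \<noteq> w"
    using uv vw no_2_cycle by blast+
  moreover have "u \<in> verts G" "v \<in> verts G" "w \<in> verts G"
    using uv vw by auto
  ultimately have "anti_centre G u v w \<or> anti_centre G v u w \<or> anti_centre G w u v"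
    using three_anti_traceableD[OF assms] by simp
  then show "u \<rightarrow> w"
    using uv vw no_2_cycle unfolding anti_centre_def by blast
qed

text \<open>A centre is adjacent to both other vertices, so for non-adjacent \<open>u\<close> and
  \<open>v\<close> only \<open>w\<close> can be one, and its two arcs point the same way.\<close>

lemma three_anti_traceable_imp_twins:
  assumes "k_anti_traceable 3 G"
    and "u \<in> verts G" "v \<in> verts G" "\<not> u \<rightarrow> v" "\<not> v \<rightarrow> u"
  shows "w \<rightarrow> u \<longleftrightarrow> w \<rightarrow> v"
proof (cases "u = v \<or> w = u \<or> w = v \<or> w \<notin> verts G")
  case True
  then show ?thesis
    using assms not_dominates_self by auto
next
  case False
  then have "anti_centre G u v w \<or> anti_centre G v u w \<or> anti_centre G w u v"
    using three_anti_traceableD[OF assms(1-3), of w] by blast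
  then show ?thesis
    using assms(4,5) no_2_cycle unfolding anti_centre_def by blast
qed

text \<open>This is the in-degree, since \<open>G\<close> has no parallel arcs.\<close>

definition rank :: "'a \<Rightarrow> nat" where
  "rank v = card {u. u \<rightarrow> v}"

lemma three_anti_traceable_imp_rank_less_iff:
  assumes "k_anti_traceable 3 G" and "u \<in> verts G" "v \<in> verts G"
  shows "rank u < rank v \<longleftrightarrow> u \<rightarrow> v"
proof -
  \<comment> \<open>Transitivity gives the inclusion of in-neighbourhoods; it is strict because
    \<open>x\<close> lies only in the larger one.\<close>
  have less: "rank x < rank y" if "x \<rightarrow> y" for x y
  proof -
    have "{z. z \<rightarrow> x} \<subset> {z. z \<rightarrow> y}"
      using that three_anti_traceable_imp_trans[OF assms(1)] not_dominates_self
      by (auto dest: transD)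
    moreover have "finite {z. z \<rightarrow> y}"
      by (rule finite_subset[OF _ finite_verts]) auto
    ultimately show ?thesis
      by (simp add: rank_def psubset_card_mono)
  qed
  moreover have "rank u = rank v" if "\<not> u \<rightarrow> v" "\<not> v \<rightarrow> u"
    using three_anti_traceable_imp_twins[OF assms that] by (simp add: rank_def)
  ultimately show ?thesis
    by (metis less_irrefl less_asym)
qed

text \<open>Vertices of equal rank are non-adjacent, whereas any three vertices include a centre,
  which is adjacent to the other two.\<close>

lemma three_anti_traceable_imp_card_rank_fibre:
  assumes "k_anti_traceable 3 G"
  shows "card {v \<in> verts G. rank v = k} \<le> 2"
proof (rule ccontr)
  assume "\<not> ?thesis"
  then obtain S where "S \<subseteq> {v \<in> verts G. rank v = k}" "card S = 3"
    by (metis not_less_eq_eq numeral_2_eq_2 numeral_3_eq_3 obtain_subset_with_card_n)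
  then obtain u v w where uvw: "u \<noteq> v" "v \<noteq> w" "u \<noteq> w" "u \<in> verts G" "v \<in> verts G" "w \<in> verts G"
      "rank u = k" "rank v = k" "rank w = k"
    by (auto simp: card_3_iff)
  then have "anti_centre G u v w \<or> anti_centre G v u w \<or> anti_centre G w u v"
    using three_anti_traceableD[OF assms] by simp
  with uvw show False
    unfolding anti_centre_def
    using three_anti_traceable_imp_rank_less_iff[OF assms] by (metis less_irrefl)
qed

lemma three_anti_traceable_imp_composition:
  assumes anti: "k_anti_traceable 3 G"
  obtains T :: "nat pair_pre_digraph" and I :: "nat \<Rightarrow> nat pair_pre_digraph"
  where "transitive_tournament (with_proj T)" "card (pverts T) > 0"
    "\<And>v. v \<in> pverts T \<Longrightarrow> independent_digraph (I v) \<and> card (pverts (I v)) \<le> 2"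
    "digraph_iso G (with_proj (composition T I))"
proof -
  note less_iff = three_anti_traceable_imp_rank_less_iff[OF anti]
  \<comment> \<open>The parts must have vertices of type \<open>nat\<close>, so the vertices of
    \<open>G\<close> are relabelled.\<close>
  obtain h :: "'a \<Rightarrow> nat" where h: "inj_on h (verts G)"
    using finite_imp_inj_to_nat_seg[OF finite_verts] by blast
  \<comment> \<open>Taking only the ranks that occur keeps every part nonempty.\<close>
  define R where "R = rank ` verts G"
  define T where "T = \<lparr>pverts = R, parcs = {(a, b). a \<in> R \<and> b \<in> R \<and> a < b}\<rparr>"
  define I :: "nat \<Rightarrow> nat pair_pre_digraph"
    where "I k = \<lparr>pverts = h ` {v \<in> verts G. rank v = k}, parcs = {}\<rparr>" for k
  have "finite R"
    by (simp add: R_def)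
  moreover have "{(a, b). a \<in> R \<and> b \<in> R \<and> a < b} \<subseteq> R \<times> R"
    by auto
  ultimately have finite: "finite {(a, b). a \<in> R \<and> b \<in> R \<and> a < b}"
    by (meson finite_SigmaI finite_subset)
  have "transitive_tournament (with_proj T)"
    by unfold_locales
      (use \<open>finite R\<close> finite in \<open>auto simp: T_def arc_to_ends_def intro!: transI\<close>)
  moreover have "card (pverts T) > 0"
    using anti \<open>finite R\<close> by (auto simp: T_def R_def card_gt_0_iff three_anti_traceable_iff)
  moreover have "independent_digraph (I k) \<and> card (pverts (I k)) \<le> 2" if "k \<in> pverts T" for k
  proof
    have "pair_digraph (I k)"
      by unfold_locales (auto simp: I_def)
    then show "independent_digraph (I k)"
      using that by (auto simp: independent_digraph_def I_def T_def R_def)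
    show "card (pverts (I k)) \<le> 2"
      using card_image_le[of "{v \<in> verts G. rank v = k}" h]
        three_anti_traceable_imp_card_rank_fibre[OF anti, of k]
      by (simp add: I_def)
  qed
  moreover have "digraph_iso G (with_proj (composition T I))"
  proof -
    let ?f = "\<lambda>v. (rank v, h v)"
    have "inj_on ?f (verts G)"
      using h by (auto simp: inj_on_def)
    moreover have "pverts (composition T I) = ?f ` verts G"
      by (auto simp: composition_def T_def R_def I_def intro: rev_image_eqI)
    moreover have "parcs (composition T I) = map_prod ?f ?f ` arcs_ends G"
    proof -
      have "parcs (composition T I) =
          {(?f u, ?f v) | u v. u \<in> verts G \<and> v \<in> verts G \<and> rank u < rank v}"
        by (auto simp: composition_def T_def R_def I_def) metis
      also have "\<dots> = {(?f u, ?f v) | u v. u \<rightarrow> v}"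
        using less_iff by (metis (no_types, lifting) adj_in_verts)
      finally show ?thesis
        by (force simp: image_iff)
    qed
    ultimately show ?thesis
      unfolding digraph_iso_with_proj_iff by blast
  qed
  ultimately show ?thesis
    using that by blast
qed

section \<open>From a composition back to triples\<close>

text \<open>Three vertices never share one part. If exactly two do, the third is a centre; if the
  parts are distinct, the vertex in the first or the last part is one.\<close>

lemma composition_imp_three_anti_traceable:
  assumes "transitive_tournament (with_proj T)"
    and I: "\<And>v. v \<in> pverts T \<Longrightarrow> independent_digraph (I v) \<and> card (pverts (I v)) \<le> 2"
    and "digraph_iso G (with_proj (composition T I))"
    and "3 \<le> card (verts G)"
  shows "k_anti_traceable 3 G"
proof -
  interpret T: transitive_tournament "with_proj T"
    by fact
  obtain f where f: "inj_on f (verts G)" "pverts (composition T I) = f ` verts G"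
      "parcs (composition T I) = map_prod f f ` arcs_ends G"
    using assms(3) unfolding digraph_iso_with_proj_iff by blast
  \<comment> \<open>The tag of \<open>f v\<close> in the composition is the part that contains
    \<open>v\<close>.\<close>
  define p where "p v = fst (f v)" for v
  have fv: "p v \<in> pverts T \<and> snd (f v) \<in> pverts (I (p v))" if "v \<in> verts G" for v
  proof -
    have "f v \<in> pverts (composition T I)"
      using that f(2) by simp
    then show ?thesis
      by (auto simp: composition_def p_def)
  qed
  have dom_iff: "u \<rightarrow> v \<longleftrightarrow> (p u, p v) \<in> parcs T" if "u \<in> verts G" "v \<in> verts G" for u v
  proof -
    have "u \<rightarrow> v \<longleftrightarrow> (f u, f v) \<in> parcs (composition T I)"
      unfolding f(3)
      using that inj_onD[OF f(1)] adj_in_verts by (auto intro: rev_image_eqI) metis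
    \<comment> \<open>Parts contribute no arcs, and \<open>T.no_2_cycle\<close> excludes loops of
      \<open>T\<close>, so the side condition in \<open>composition\<close> that the tags differ
      holds automatically.\<close>
    also have "\<dots> \<longleftrightarrow> (p u, p v) \<in> parcs T"
      using fv[OF that(1)] fv[OF that(2)] I T.no_2_cycle
      by (cases "f u"; cases "f v") (auto simp: composition_def p_def independent_digraph_def)
    finally show ?thesis .
  qed
  have "anti_centre G u v w \<or> anti_centre G v u w \<or> anti_centre G w u v"
    if V: "u \<in> verts G" "v \<in> verts G" "w \<in> verts G" and dist: "distinct [u, v, w]" for u v w
  proof -
    have "\<not> (p u = p v \<and> p u = p w)"
    proof
      assume eq: "p u = p v \<and> p u = p w"
      have "f u \<noteq> f v" "f u \<noteq> f w" "f v \<noteq> f w"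
        using V dist f(1) by (auto dest: inj_onD)
      \<comment> \<open>With equal tags, injectivity of \<open>f\<close> must show in the second
        components.\<close>
      with eq have "card {snd (f u), snd (f v), snd (f w)} = 3"
        by (auto simp: p_def prod_eq_iff)
      moreover have "{snd (f u), snd (f v), snd (f w)} \<subseteq> pverts (I (p u))"
        using V eq fv by (metis empty_subsetI insert_subset)
      moreover have "finite (pverts (I (p u)))"
        using I[of "p u"] fv[OF V(1)]
        by (simp add: independent_digraph_def pair_digraph_def pair_fin_digraph_def
            pair_fin_digraph_axioms_def)
      ultimately have "3 \<le> card (pverts (I (p u)))"
        by (metis card_mono)
      then show False
        using I[of "p u"] fv[OF V(1)] by simp
    qed
    moreover have "(p x, p y) \<in> parcs T \<or> (p y, p x) \<in> parcs T \<or> p x = p y"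
      if "x \<in> verts G" "y \<in> verts G" for x y
      using T.semicomplete[of "p x" "p y"] fv that by auto
    note this[OF V(1,2)] this[OF V(1,3)] this[OF V(2,3)]
    moreover have "(a, c) \<in> parcs T" if "(a, b) \<in> parcs T" "(b, c) \<in> parcs T" for a b c
      using T.transitive that by (auto dest: transD)
    ultimately show ?thesis
      unfolding anti_centre_def dom_iff[OF V(1,2)] dom_iff[OF V(2,1)] dom_iff[OF V(1,3)]
        dom_iff[OF V(3,1)] dom_iff[OF V(2,3)] dom_iff[OF V(3,2)]
      by metis
  qed
  with assms(4) show ?thesis
    by (simp add: three_anti_traceable_iff)
qed

end

theorem theorem2:
  fixes D :: "('a, 'b) pre_digraph"
  assumes "oriented_graph D"
    and "card (verts D) \<ge> 3"
  shows "k_anti_traceable 3 D \<longleftrightarrow>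
    (\<exists>(t :: nat) (T :: nat pair_pre_digraph) (I :: nat \<Rightarrow> nat pair_pre_digraph).
       t > 0 \<and> transitive_tournament (with_proj T) \<and> card (pverts T) = t \<and>
       (\<forall>v \<in> pverts T. independent_digraph (I v) \<and> card (pverts (I v)) \<le> 2) \<and>
       digraph_iso D (with_proj (composition T I)))"
proof -
  interpret oriented_graph D
    by fact
  show ?thesis (is "_ \<longleftrightarrow> ?R")
  proof
    assume "k_anti_traceable 3 D"
    then show ?R
      by (rule three_anti_traceable_imp_composition) blast
  next
    assume ?R
    then show "k_anti_traceable 3 D"
      using composition_imp_three_anti_traceable[OF _ _ _ assms(2)] by blast
  qed
qed

end
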